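(* Let $n,k,s$ be positive integers with $k\geq 2$, $s\geq 2$ and $n\geq sk$. Then $$\chi\left(KG^{2}(n,k)_{\widetilde{s\text{-}stab}}\right)=n-s(k-1).$$
   Context: A $k$-subset $S\subseteq[n]$ is almost $s$-stable if $|i-j|\geq s$ for all distinct $i,j\in S$. The almost $s$-stable Kneser graph $KG^{2}(n,k)_{\widetilde{s\text{-}stab}}$ has as vertices the almost $s$-stable $k$-subsets of $[n]$, two vertices being adjacent iff they are disjoint. $\chi$ is the chromatic number. *)

theory Defs
  imports "Graph_Theory.Graph_Theory"
begin

definition proper_coloring :: "'a pair_pre_digraph \<Rightarrow> nat \<Rightarrow> ('a \<Rightarrow> nat) \<Rightarrow> bool" where
  "proper_coloring G m c \<longleftrightarrow>
     c ` pverts G \<subseteq> {..<m} \<and> (\<forall>(u, v) \<in> parcs G. c u \<noteq> c v)"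

text \<open>Only meaningful when some proper coloring with finitely many colors exists, e.g. for
  every finite loop-free graph (lemma \<open>pair_graph_ex_proper_coloring\<close>).\<close>

definition chromatic_number :: "'a pair_pre_digraph \<Rightarrow> nat" where
  "chromatic_number G = (LEAST m. \<exists>c. proper_coloring G m c)"

lemma pair_graph_ex_proper_coloring:
  assumes "pair_graph G"
  shows "\<exists>m c. proper_coloring G m c"
proof -
  interpret pair_graph G by fact
  obtain c and m :: nat where c: "c ` pverts G = {i. i < m}" "inj_on c (pverts G)"
    using finite_imp_inj_to_nat_seg[OF pair_finite_verts] by blast
  have "c u \<noteq> c v" if "(u, v) \<in> parcs G" for u v
    using c(2) that in_arcsD1[OF that] in_arcsD2[OF that] pair_no_loops[OF that]
    by (auto dest: inj_onD)
  then have "proper_coloring G m c"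
    using c(1) unfolding proper_coloring_def by auto
  then show ?thesis by blast
qed

definition almost_stable :: "nat \<Rightarrow> nat set \<Rightarrow> bool" where
  "almost_stable s S \<longleftrightarrow> (\<forall>i \<in> S. \<forall>j \<in> S. i \<noteq> j \<longrightarrow> \<bar>int i - int j\<bar> \<ge> int s)"

definition almost_stable_subsets :: "nat \<Rightarrow> nat \<Rightarrow> nat \<Rightarrow> nat set set" where
  "almost_stable_subsets n k s = {S. S \<subseteq> {1..n} \<and> card S = k \<and> almost_stable s S}"

definition almost_stable_kneser_graph :: "nat \<Rightarrow> nat \<Rightarrow> nat \<Rightarrow> nat set pair_pre_digraph" where
  "almost_stable_kneser_graph n k s =
     \<lparr>pverts = almost_stable_subsets n k s,
      parcs = {(S, T). S \<in> almost_stable_subsets n k s \<and> T \<in> almost_stable_subsets n k s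
                     \<and> S \<inter> T = {}}\<rparr>"

text \<open>For \<open>k = 0\<close> the empty set would be a vertex disjoint from itself, i.e. a loop.\<close>

lemma pair_graph_almost_stable_kneser_graph:
  assumes "k \<ge> 1"
  shows "pair_graph (almost_stable_kneser_graph n k s)"
proof -
  let ?V = "almost_stable_subsets n k s"
  have V: "finite ?V"
    by (rule finite_subset[of _ "Pow {1..n}"]) (auto simp: almost_stable_subsets_def)
  have E: "finite {(S, T). S \<in> ?V \<and> T \<in> ?V \<and> S \<inter> T = {}}"
    by (rule finite_subset[of _ "?V \<times> ?V"]) (auto simp: V)
  have "S \<noteq> {}" if "S \<in> ?V" for S
    using that assms by (auto simp: almost_stable_subsets_def)
  then have L: "S \<noteq> T" if "S \<in> ?V" "S \<inter> T = {}" for S T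
    using that by blast
  show ?thesis
  proof unfold_locales
    show "symmetric (with_proj (almost_stable_kneser_graph n k s))"
      unfolding symmetric_def by (rule symI) (auto simp: almost_stable_kneser_graph_def)
  qed (use V E L in \<open>auto simp: almost_stable_kneser_graph_def\<close>)
qed

end

theory Submission
  imports Defs
begin

text \<open>
  Colouring a set by its minimum gives the upper bound, since an almost \<open>s\<close>-stable
  \<open>k\<close>-set spreads over at least \<open>s (k - 1) + 1\<close> points.

  The lower bound is an application of the octahedral Tucker lemma: an antipodal labelling of the
  nonzero sign vectors of length \<open>n\<close> by \<open>\<plusminus>1, \<dots>, \<plusminus>m\<close> without comparable vectors of opposite
  labels forces \<open>n \<le> m\<close>. Tucker's lemma itself follows from Fan's parity count of alternating
  maximal chains in nested hemispheres.

  A proper colouring with \<open>m\<close> colours yields such a labelling with \<open>s (k - 1) + m\<close> labels. For even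
  \<open>s\<close> one can use the length of a longest alternating subsequence: in one with \<open>s (k - 1) + 1\<close>
  terms every \<open>s\<close>-th term has the same sign, so there is a monochromatic almost \<open>s\<close>-stable
  \<open>k\<close>-set. For odd \<open>s\<close> this fails, and every \<open>s\<close>-th step of the alternation is replaced by
  an alternation of the sign twisted by the parity of the position. Such a step between
  terms of different signs skips a position, which is exactly the gap that is missing otherwise.
  Short patterns label \<open>X\<close> by their length, with the (twisted) sign of their last term; if there is
  a long pattern, the label is a colour of an almost \<open>s\<close>-stable set in one of the two sign classes.
\<close>

section \<open>Tucker's lemma\<close>

lemma even_card_involution:
  assumes "finite B" "\<And>x. x \<in> B \<Longrightarrow> g x \<in> B" "\<And>x. x \<in> B \<Longrightarrow> g (g x) = x"
    "\<And>x. x \<in> B \<Longrightarrow> g x \<noteq> x"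
  shows "even (card B)"
  using assms
proof (induction B rule: finite_psubset_induct)
  case (psubset B)
  show ?case
  proof (cases "B = {}")
    case False
    then obtain x where x: "x \<in> B" by blast
    let ?B = "B - {x, g x}"
    have "even (card ?B)"
    proof (rule psubset.IH)
      show "g y \<in> ?B" if "y \<in> ?B" for y
        using that psubset.prems(1,2) x by (metis Diff_iff insert_iff empty_iff)
    qed (use x psubset.prems in auto)
    moreover have "card B = card ?B + 2"
    proof -
      have "{x, g x} \<subseteq> B" "card {x, g x} = 2"
        using x psubset.prems(1)[OF x] psubset.prems(3)[OF x] by auto
      then show ?thesis
        using psubset.hyps card_Diff_subset[of "{x, g x}" B] card_mono[of B "{x, g x}"] by simp
    qed
    ultimately show ?thesis by simp
  qed simp
qed

section \<open>Alternating label sets and the parity of their facets\<close>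

text \<open>For distinct absolute values: listed from the largest down, the signs alternate and
  start with \<open>b\<close>. Counting larger elements modulo 2 avoids sorting.\<close>

definition top_alternating :: "bool \<Rightarrow> int set \<Rightarrow> bool" where
  "top_alternating b S \<longleftrightarrow> (\<forall>x\<in>S. (x > 0) = (b = even (card {y\<in>S. \<bar>x\<bar> < \<bar>y\<bar>})))"

lemma top_alternating_empty [simp]: "top_alternating b {}"
  by (simp add: top_alternating_def)

lemma top_alternating_insert:
  assumes "finite S" "\<And>y. y \<in> S \<Longrightarrow> \<bar>y\<bar> < \<bar>x\<bar>"
  shows "top_alternating b (insert x S) \<longleftrightarrow> (x > 0) = b \<and> top_alternating (\<not> b) S"
proof -
  have x: "{y \<in> insert x S. \<bar>x\<bar> < \<bar>y\<bar>} = {}"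
    using assms(2) by force
  have y: "card {y \<in> insert x S. \<bar>z\<bar> < \<bar>y\<bar>} = Suc (card {y \<in> S. \<bar>z\<bar> < \<bar>y\<bar>})" if "z \<in> S" for z
  proof -
    have "{y \<in> insert x S. \<bar>z\<bar> < \<bar>y\<bar>} = insert x {y \<in> S. \<bar>z\<bar> < \<bar>y\<bar>}"
      using assms(2)[OF that] by auto
    moreover have "x \<notin> S"
      using assms(2) by blast
    ultimately show ?thesis
      using assms(1) by simp
  qed
  show ?thesis
    unfolding top_alternating_def ball_simps x using y by auto
qed

lemma top_alternating_unique:
  assumes "finite S" "S \<noteq> {}" "top_alternating b S" "top_alternating c S"
  shows "b = c"
  using assms unfolding top_alternating_def by (metis all_not_in_conv)

lemma top_alternating_uminus:
  assumes "0 \<notin> S"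
  shows "top_alternating b (uminus ` S) \<longleftrightarrow> top_alternating (\<not> b) S"
proof -
  have "card {y \<in> uminus ` S. \<bar>x\<bar> < \<bar>y\<bar>} = card {y \<in> S. \<bar>x\<bar> < \<bar>y\<bar>}" for x :: int
  proof -
    have "{y \<in> uminus ` S. \<bar>x\<bar> < \<bar>y\<bar>} = uminus ` {y \<in> S. \<bar>x\<bar> < \<bar>y\<bar>}"
      by auto
    then show ?thesis
      by (simp add: card_image)
  qed
  moreover have "(- x > 0) = (\<not> x > 0)" if "x \<in> S" for x
    using that assms by (metis linorder_neqE_linordered_idom neg_0_less_iff_less order_less_asym)
  ultimately show ?thesis
    unfolding top_alternating_def by auto
qed

text \<open>An alternating set has exactly one deletion of top sign \<open>b\<close>: that of its
  largest or of its smallest element. Any other set has none or two, from deleting either member of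
  a unique adjacent pair of equal signs. The induction peels off the element of largest absolute
  value.\<close>

lemma odd_card_alternating_deletions:
  assumes "finite S" "S \<noteq> {}" "inj_on abs S"
  shows "odd (card {x\<in>S. top_alternating b (S - {x})}) \<longleftrightarrow> (\<exists>c. top_alternating c S)"
  using assms
proof (induction S arbitrary: b rule: finite_ranking_induct[where f = abs])
  case empty
  then show ?case by simp
next
  case (insert x S)
  show ?case
  proof (cases "x \<in> S \<or> S = {}")
    case True
    then show ?thesis
    proof
      assume "x \<in> S"
      then show ?thesis using insert.IH insert.prems by (simp add: insert_absorb)
    next
      assume "S = {}"
      moreover have "{z. z = x \<and> top_alternating b ({x} - {z})} = {x}" by auto
      ultimately show ?thesis using top_alternating_insert[of "{}" x] by auto
    qed
  next
    case False
    have less: "\<bar>y\<bar> < \<bar>x\<bar>" if "y \<in> S" for y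
      using insert.hyps(2)[OF that] insert.prems(2) that False
      by (metis inj_onD insertI1 insert_iff order_le_imp_less_or_eq)
    have ins: "top_alternating c (insert x S) \<longleftrightarrow> (x > 0) = c \<and> top_alternating (\<not> c) S" for c
      using insert.hyps(1) less by (rule top_alternating_insert)
    have IH: "odd (card {z\<in>S. top_alternating c (S - {z})}) \<longleftrightarrow> (\<exists>c. top_alternating c S)" for c
      using insert.IH insert.prems False by (auto simp: inj_on_insert)
    let ?L = "{z\<in>insert x S. top_alternating b (insert x S - {z})}"
    let ?A = "{z\<in>{x}. top_alternating b S}"
    let ?B = "{z\<in>S. (x > 0) = b \<and> top_alternating (\<not> b) (S - {z})}"
    have "insert x S - {z} = insert x (S - {z})" if "z \<in> S" for z
      using that False by auto
    moreover have "insert x S - {x} = S"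
      using False by auto
    moreover have "top_alternating b (insert x (S - {z})) \<longleftrightarrow>
        (x > 0) = b \<and> top_alternating (\<not> b) (S - {z})" for z
      using insert.hyps(1) less by (intro top_alternating_insert) auto
    ultimately have "?L = ?A \<union> ?B"
      by auto
    moreover have "?A \<inter> ?B = {}"
      using False by auto
    ultimately have card: "card ?L = card ?A + card ?B"
      using insert.hyps(1) by (simp add: card_Un_disjoint)
    have A: "odd (card ?A) \<longleftrightarrow> top_alternating b S"
      by (cases "top_alternating b S") auto
    have B: "odd (card ?B) \<longleftrightarrow> (x > 0) = b \<and> (\<exists>c. top_alternating c S)"
      using IH[of "\<not> b"] by (cases "(x > 0) = b") auto
    have uniq: "\<not> (top_alternating b S \<and> top_alternating (\<not> b) S)"
      using top_alternating_unique[OF insert.hyps(1), of b "\<not> b"] False by auto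
    have ex: "(\<exists>c. P c) \<longleftrightarrow> P b \<or> P (\<not> b)" for P
      by (cases b) (auto simp: ex_bool_eq)
    have "odd (card ?L) \<longleftrightarrow> odd (card ?A) \<noteq> odd (card ?B)"
      unfolding card by simp
    also have "\<dots> \<longleftrightarrow> (x > 0) = b \<and> top_alternating (\<not> b) S \<or> (x > 0) \<noteq> b \<and> top_alternating b S"
      unfolding A B ex[of "\<lambda>c. top_alternating c S"] using uniq by blast
    also have "\<dots> \<longleftrightarrow> (\<exists>c. top_alternating c (insert x S))"
      unfolding ex[of "\<lambda>c. top_alternating c (insert x S)"] by (simp only: ins not_not not_iff)
    finally show ?thesis .
  qed
qed

definition alternating_on :: "('a \<Rightarrow> int) \<Rightarrow> 'a set \<Rightarrow> bool \<Rightarrow> bool" where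
  "alternating_on f I b \<longleftrightarrow> inj_on f I \<and> top_alternating b (f ` I)"

lemma alternating_on_cong:
  assumes "\<And>i. i \<in> I \<Longrightarrow> f i = g i"
  shows "alternating_on f I b = alternating_on g I b"
  unfolding alternating_on_def using inj_on_cong[of I f g] image_cong[of I I f g] assms by auto

text \<open>Injective labels reduce this to the label set, whose absolute values are distinct as no
  labels are complementary. If two indices share a label, only their deletions can be injective, and
  both leave the same label set, so the count is 0 or 2.\<close>

lemma odd_card_alternating_facets:
  assumes "finite C" "C \<noteq> {}" and compl: "\<And>i j. i \<in> C \<Longrightarrow> j \<in> C \<Longrightarrow> f i \<noteq> - f j"
  shows "odd (card {i\<in>C. alternating_on f (C - {i}) b}) \<longleftrightarrow> (\<exists>c. alternating_on f C c)"
proof (cases "inj_on f C")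
  case True
  have "f ` (C - {i}) = f ` C - {f i}" if "i \<in> C" for i
    using True that by (auto simp: inj_on_def)
  then have "f ` {i\<in>C. alternating_on f (C - {i}) b} = {x\<in>f ` C. top_alternating b (f ` C - {x})}"
    using True by (auto simp: alternating_on_def inj_on_diff)
  moreover have "card (f ` {i\<in>C. alternating_on f (C - {i}) b}) = card {i\<in>C. alternating_on f (C - {i}) b}"
    by (rule card_image, rule inj_on_subset[OF True]) auto
  moreover have "inj_on abs (f ` C)"
    using compl by (force simp: inj_on_def abs_eq_iff)
  ultimately show ?thesis
    using odd_card_alternating_deletions[of "f ` C" b] assms True by (simp add: alternating_on_def)
next
  case False
  then obtain i j where ij: "i \<in> C" "j \<in> C" "i \<noteq> j" "f i = f j"
    by (auto simp: inj_on_def)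
  have img: "f ` (C - {i}) = f ` C" "f ` (C - {j}) = f ` C"
    using ij by (auto simp: image_iff) (metis DiffI singletonD)+
  have "inj_on f (C - {i}) = inj_on f (C - {j})"
    using img assms(1) ij by (simp add: inj_on_iff_eq_card)
  then have "alternating_on f (C - {i}) b = alternating_on f (C - {j}) b"
    using img by (simp add: alternating_on_def)
  moreover have "l \<in> {i, j}" if "l \<in> C" "alternating_on f (C - {l}) b" for l
    using that ij by (auto simp: alternating_on_def inj_on_def)
  ultimately have "{l\<in>C. alternating_on f (C - {l}) b} = {} \<or> {l\<in>C. alternating_on f (C - {l}) b} = {i, j}"
    using ij by blast
  moreover have "even (card {i, j})"
    using ij by simp
  ultimately have "even (card {l\<in>C. alternating_on f (C - {l}) b})"
    by (elim disjE) (simp_all only: card.empty even_zero)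
  then show ?thesis
    using False by (simp add: alternating_on_def)
qed

section \<open>Maximal chains of sign vectors and the facet involution\<close>

text \<open>The sign vector with support \<open>abs ` X\<close>: position \<open>i\<close> carries \<open>+\<close> if \<open>i \<in> X\<close> and \<open>-\<close> if
  \<open>- i \<in> X\<close>. The condition \<open>- x \<notin> X\<close> also excludes \<open>0\<close>.\<close>

definition sign_vectors :: "nat \<Rightarrow> int set set" where
  "sign_vectors n = {X. X \<noteq> {} \<and> X \<subseteq> {- int n..int n} \<and> (\<forall>x\<in>X. - x \<notin> X)}"

lemma uminus_in_sign_vectors: "X \<in> sign_vectors n \<Longrightarrow> uminus ` X \<in> sign_vectors n"
  by (force simp: sign_vectors_def)

text \<open>A signed permutation encodes the maximal chain formed by the sets of its prefixes.\<close>

definition signed_perms :: "nat \<Rightarrow> int list set" where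
  "signed_perms d = {w. length w = d \<and> distinct (map abs w) \<and> abs ` set w = {1..int d}}"

lemma finite_signed_perms: "finite (signed_perms d)"
proof (rule finite_subset)
  show "signed_perms d \<subseteq> {w. set w \<subseteq> {- int d..int d} \<and> length w = d}"
    by (force simp: signed_perms_def)
qed (simp add: finite_lists_length_eq)

lemma take_signed_perm_in_sign_vectors:
  assumes "w \<in> signed_perms d" "d \<le> n" "i \<in> {1..d}"
  shows "set (take i w) \<in> sign_vectors n"
proof -
  have w: "length w = d" "distinct (map abs w)" "abs ` set w = {1..int d}"
    using assms by (auto simp: signed_perms_def)
  have sub: "set (take i w) \<subseteq> set w"
    by (rule set_take_subset)
  have abs: "\<bar>x\<bar> \<in> {1..int d}" if "x \<in> set w" for x
    using w(3) that by blast
  have "inj_on abs (set w)"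
    using w(2) by (simp add: distinct_map)
  then have "- x \<notin> set w" if "x \<in> set w" for x
    using that abs[OF that] by (auto simp: inj_on_def) (metis abs_minus_cancel abs_zero not_one_le_zero neg_equal_zero)
  moreover have "set (take i w) \<noteq> {}"
    using assms(3) w(1) by auto
  moreover have "x \<in> {- int n..int n}" if "x \<in> set w" for x
    using abs[OF that] assms(2) by auto
  ultimately show ?thesis
    using sub by (auto simp: sign_vectors_def)
qed

text \<open>The other maximal chain containing the facet of \<open>w\<close> that omits its \<open>i\<close>-th member.\<close>

definition neighbour :: "nat \<Rightarrow> int list \<times> nat \<Rightarrow> int list \<times> nat" where
  "neighbour d = (\<lambda>(w, i).
     (if i < d then w[i - 1 := w ! i, i := w ! (i - 1)] else w[i - 1 := - w ! (i - 1)], i))"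

lemma snd_neighbour [simp]: "snd (neighbour d p) = snd p"
  by (simp add: neighbour_def split: prod.split)

lemma neighbour_swap: "neighbour d (us @ a # b # vs, Suc (length us)) = (us @ b # a # vs, Suc (length us))"
  if "Suc (length us) < d"
  using that by (simp add: neighbour_def nth_append list_update_append)

lemma neighbour_negate: "neighbour d (us @ [a], Suc (length us)) = (us @ [- a], Suc (length us))"
  if "d \<le> Suc (length us)"
  using that by (simp add: neighbour_def nth_append list_update_append)

text \<open>An inner facet of the hemisphere lies in a second chain of it, and
  \<open>neighbour\<close> exchanges the two. The hypothesis on \<open>last w\<close> excludes the
  boundary: flipping a final entry \<open>int d\<close> would leave the hemisphere.\<close>

lemma neighbour_signed_perm:
  assumes w: "w \<in> signed_perms d" "int d \<in> set w"
    and i: "i \<in> {1..d}" and last: "i = d \<Longrightarrow> last w \<noteq> int d"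
  shows "neighbour d (w, i) = (fst (neighbour d (w, i)), i)"
    and "fst (neighbour d (w, i)) \<in> signed_perms d"
    and "int d \<in> set (fst (neighbour d (w, i)))"
    and "i = d \<Longrightarrow> last (fst (neighbour d (w, i))) \<noteq> int d"
    and "j \<noteq> i \<Longrightarrow> j \<le> d \<Longrightarrow> set (take j (fst (neighbour d (w, i)))) = set (take j w)"
    and "neighbour d (neighbour d (w, i)) = (w, i)"
    and "neighbour d (w, i) \<noteq> (w, i)"
proof -
  have len: "length w = d"
    using w(1) by (simp add: signed_perms_def)
  show "neighbour d (w, i) = (fst (neighbour d (w, i)), i)"
    by (metis prod.collapse snd_conv snd_neighbour)
  have "fst (neighbour d (w, i)) \<in> signed_perms d \<and> int d \<in> set (fst (neighbour d (w, i))) \<and>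
      (i = d \<longrightarrow> last (fst (neighbour d (w, i))) \<noteq> int d) \<and>
      (j \<noteq> i \<longrightarrow> j \<le> d \<longrightarrow> set (take j (fst (neighbour d (w, i)))) = set (take j w)) \<and>
      neighbour d (neighbour d (w, i)) = (w, i) \<and> neighbour d (w, i) \<noteq> (w, i)"
  proof (cases "i < d")
    case True
    obtain us vs' where us: "w = us @ vs'" "length us = i - 1"
      using len True by (metis append_take_drop_id length_take less_imp_diff_less min.absorb4)
    then obtain a vs'' where "vs' = a # vs''"
      using len i by (cases vs') auto
    moreover from this obtain b vs where "vs'' = b # vs"
      using len i True us by (cases vs'') auto
    ultimately have w_eq: "w = us @ a # b # vs"
      using us by simp
    have i': "i = Suc (length us)"
      using us(2) i by simp
    have "set (take j (us @ b # a # vs)) = set (take j (us @ a # b # vs))" if "j \<noteq> i"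
    proof (cases "j < i")
      case True
      then have "j - length us = 0"
        using i' by simp
      then show ?thesis by simp
    next
      case False
      then have "length us + 2 \<le> j"
        using that i' by simp
      then obtain l where "j = length us + 2 + l"
        using le_Suc_ex by blast
      then show ?thesis by (simp add: insert_commute)
    qed
    moreover have "us @ b # a # vs \<in> signed_perms d" "a \<noteq> b"
    proof -
      have "set (us @ b # a # vs) = set w" "length (us @ b # a # vs) = length w"
        "distinct (map abs (us @ b # a # vs)) = distinct (map abs w)"
        by (auto simp: w_eq)
      then show "us @ b # a # vs \<in> signed_perms d"
        using w(1) unfolding signed_perms_def by blast
      have "distinct w"
        using w(1) by (simp add: signed_perms_def distinct_map)
      then show "a \<noteq> b"
        by (simp add: w_eq)
    qed
    moreover have "neighbour d (w, i) = (us @ b # a # vs, i)" "neighbour d (us @ b # a # vs, i) = (w, i)"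
      using True by (simp_all add: w_eq i' neighbour_swap)
    moreover have "int d \<in> set (us @ b # a # vs)"
      using w(2) by (auto simp: w_eq)
    moreover have "i \<noteq> d"
      using True by simp
    ultimately show ?thesis
      unfolding w_eq by simp
  next
    case False
    then have "i = d"
      using i by simp
    obtain us a where w_eq: "w = us @ [a]"
      using len i by (cases w rule: rev_cases) auto
    have d: "d = Suc (length us)"
      using len w_eq by simp
    have "a \<noteq> int d"
      using last[OF \<open>i = d\<close>] by (simp add: w_eq)
    then have us: "int d \<in> set us"
      using w(2) by (simp add: w_eq)
    have dist: "\<bar>a\<bar> \<notin> abs ` set us" "\<bar>a\<bar> \<in> {1..int d}"
      using w(1) unfolding signed_perms_def w_eq by auto
    have "- a \<noteq> int d" "- a \<noteq> a"
      using dist us by force+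
    moreover have "us @ [- a] \<in> signed_perms d"
      using w(1) by (simp add: signed_perms_def w_eq)
    moreover have "neighbour d (w, d) = (us @ [- a], d)" "neighbour d (us @ [- a], d) = (w, d)"
      by (simp_all add: w_eq d neighbour_negate)
    moreover have "take j (us @ [- a]) = take j w" if "j \<noteq> d" "j \<le> d"
      using that by (simp add: w_eq d)
    ultimately show ?thesis
      using us by (simp add: w_eq \<open>i = d\<close>)
  qed
  then show "fst (neighbour d (w, i)) \<in> signed_perms d"
    and "int d \<in> set (fst (neighbour d (w, i)))"
    and "i = d \<Longrightarrow> last (fst (neighbour d (w, i))) \<noteq> int d"
    and "j \<noteq> i \<Longrightarrow> j \<le> d \<Longrightarrow> set (take j (fst (neighbour d (w, i)))) = set (take j w)"
    and "neighbour d (neighbour d (w, i)) = (w, i)"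
    and "neighbour d (w, i) \<noteq> (w, i)"
    by blast+
qed

text \<open>This identifies the boundary of a hemisphere: dropping the new positive position from
  the end of a chain gives exactly the chains of one dimension less.\<close>

lemma append_signed_perm_iff:
  "w @ [int (Suc d)] \<in> signed_perms (Suc d) \<longleftrightarrow> w \<in> signed_perms d"
proof -
  have ins: "insert (1 + int d) {1..int d} = {1..1 + int d}" and notin: "1 + int d \<notin> {1..int d}"
    by auto
  have *: "1 + int d \<notin> A \<and> insert (1 + int d) A = {1..1 + int d} \<longleftrightarrow> A = {1..int d}" for A
    unfolding ins[symmetric] using notin by (metis insert_ident)
  have **: "w @ [int (Suc d)] \<in> signed_perms (Suc d) \<longleftrightarrow> length w = d \<and> distinct (map abs w) \<and>
      (1 + int d \<notin> abs ` set w \<and> insert (1 + int d) (abs ` set w) = {1..1 + int d})"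
    unfolding signed_perms_def mem_Collect_eq length_append map_append distinct_append set_append image_Un
    by simp
  show ?thesis
    unfolding ** * by (simp add: signed_perms_def)
qed

section \<open>Parity count over nested hemispheres\<close>

text \<open>The hypotheses of the octahedral Tucker lemma; the case \<open>Y = X\<close> of
  \<open>no_complementary\<close> says that labels are nonzero.\<close>

locale tucker_labelling =
  fixes n :: nat and lab :: "int set \<Rightarrow> int"
  assumes antipodal: "\<And>X. X \<in> sign_vectors n \<Longrightarrow> lab (uminus ` X) = - lab X"
    and no_complementary: "\<And>X Y. X \<in> sign_vectors n \<Longrightarrow> Y \<in> sign_vectors n \<Longrightarrow> X \<subseteq> Y \<Longrightarrow> lab X \<noteq> - lab Y"
begin

definition flag_lab :: "int list \<Rightarrow> nat \<Rightarrow> int" where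
  "flag_lab w i = lab (set (take i w))"

text \<open>The hemisphere consists of the chains of dimension \<open>d\<close> with sign \<open>+\<close> at position \<open>d\<close>; its
  boundary is formed by the chains of dimension \<open>d - 1\<close>.\<close>

definition upper_alternating :: "nat \<Rightarrow> int list set" where
  "upper_alternating d =
     {w\<in>signed_perms d. int d \<in> set w \<and> (\<exists>b. alternating_on (flag_lab w) {1..d} b)}"

lemma flag_lab_no_complementary:
  assumes "w \<in> signed_perms d" "d \<le> n" "i \<in> {1..d}" "j \<in> {1..d}"
  shows "flag_lab w i \<noteq> - flag_lab w j"
proof -
  have V: "set (take i w) \<in> sign_vectors n" "set (take j w) \<in> sign_vectors n"
    using assms take_signed_perm_in_sign_vectors by blast+
  show ?thesis
  proof (cases "i \<le> j")
    case True
    then show ?thesis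
      using no_complementary[OF V] by (simp add: flag_lab_def set_take_subset_set_take)
  next
    case False
    then show ?thesis
      using no_complementary[OF V(2,1)] by (auto simp add: flag_lab_def set_take_subset_set_take)
  qed
qed

lemma flag_lab_cong: "set (take i w) = set (take i w') \<Longrightarrow> flag_lab w i = flag_lab w' i"
  by (simp add: flag_lab_def)

text \<open>Negating a chain swaps the two hemispheres and, by antipodality, the top sign. So lower
  chains with top sign \<open>+\<close> match upper chains with top sign \<open>-\<close>, and the
  count over the sphere becomes one over the upper hemisphere.\<close>

lemma odd_card_alternating_boundary:
  assumes "1 \<le> d" "d \<le> n"
  shows "odd (card {w \<in> signed_perms d. alternating_on (flag_lab w) {1..d} True}) \<longleftrightarrow>
    odd (card (upper_alternating d))"
proof -
  let ?P = "\<lambda>d' b. {w \<in> signed_perms d. d' \<in> set w \<and> alternating_on (flag_lab w) {1..d} b}"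
  have fin: "finite (?P d' b)" for d' b
    using finite_signed_perms by simp
  have mem: "int d \<in> set w \<or> - int d \<in> set w" "\<not> (int d \<in> set w \<and> - int d \<in> set w)"
    if "w \<in> signed_perms d" for w
  proof -
    have "int d \<in> abs ` set w" "inj_on abs (set w)"
      using that assms(1) by (auto simp: signed_perms_def distinct_map)
    then show "int d \<in> set w \<or> - int d \<in> set w"
      by (metis abs_if image_iff minus_equation_iff)
    show "\<not> (int d \<in> set w \<and> - int d \<in> set w)"
      using inj_onD[OF \<open>inj_on abs (set w)\<close>, of "int d" "- int d"] assms(1) by auto
  qed
  have neg: "map uminus w \<in> ?P (- x) (\<not> b)" if "w \<in> ?P x b" for w x b
  proof -
    have w: "w \<in> signed_perms d" "x \<in> set w" "alternating_on (flag_lab w) {1..d} b"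
      using that by auto
    have lab: "flag_lab (map uminus w) i = - flag_lab w i" if "i \<in> {1..d}" for i
      using antipodal[OF take_signed_perm_in_sign_vectors[OF w(1) assms(2) that]]
      by (simp add: flag_lab_def take_map)
    have "flag_lab w i \<noteq> 0" if "i \<in> {1..d}" for i
      using flag_lab_no_complementary[OF w(1) assms(2) that that] by auto
    then have "0 \<notin> flag_lab w ` {1..d}"
      by (metis imageE)
    then have "top_alternating (\<not> b) (uminus ` flag_lab w ` {1..d})"
      using w(3) top_alternating_uminus[of "flag_lab w ` {1..d}" "\<not> b"]
      unfolding alternating_on_def not_not by blast
    then have "alternating_on (\<lambda>i. - flag_lab w i) {1..d} (\<not> b)"
      using w(3) unfolding alternating_on_def image_image inj_on_def neg_equal_iff_equal by blast
    moreover have "alternating_on (flag_lab (map uminus w)) {1..d} (\<not> b) =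
        alternating_on (\<lambda>i. - flag_lab w i) {1..d} (\<not> b)"
      using lab by (rule alternating_on_cong)
    ultimately have "alternating_on (flag_lab (map uminus w)) {1..d} (\<not> b)"
      by blast
    moreover have "map uminus w \<in> signed_perms d"
      using w(1) by (simp add: signed_perms_def comp_def image_image)
    ultimately show ?thesis
      using w(2) by simp
  qed
  have "map uminus ` ?P (- int d) True \<subseteq> ?P (int d) False"
    using neg[of _ "- int d" True] unfolding minus_minus not_True_eq_False by (rule image_subsetI)
  moreover have "map uminus ` ?P (int d) False \<subseteq> ?P (- int d) True"
    using neg[of _ "int d" False] unfolding not_False_eq_True by (rule image_subsetI)
  ultimately have "bij_betw (map uminus) (?P (- int d) True) (?P (int d) False)"
    by (intro bij_betw_byWitness[where f' = "map uminus"] ballI) (simp_all add: comp_def)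
  then have card_neg: "card (?P (- int d) True) = card (?P (int d) False)"
    by (rule bij_betw_same_card)
  have split: "{w \<in> signed_perms d. alternating_on (flag_lab w) {1..d} True} = ?P (int d) True \<union> ?P (- int d) True"
  proof (intro equalityI subsetI)
    fix w assume "w \<in> {w \<in> signed_perms d. alternating_on (flag_lab w) {1..d} True}"
    then have "w \<in> signed_perms d" "alternating_on (flag_lab w) {1..d} True" by simp_all
    then show "w \<in> ?P (int d) True \<union> ?P (- int d) True"
      using mem(1)[of w] by simp
  qed (elim UnE; simp)
  have disj1: "?P (int d) True \<inter> ?P (- int d) True = {}"
  proof (rule Int_emptyI)
    show False if "w \<in> ?P (int d) True" "w \<in> ?P (- int d) True" for w
      using that mem(2)[of w] by simp
  qed
  have disj2: "?P (int d) True \<inter> ?P (int d) False = {}"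
  proof (rule Int_emptyI)
    fix w assume "w \<in> ?P (int d) True" "w \<in> ?P (int d) False"
    then have "top_alternating True (flag_lab w ` {1..d})" "top_alternating False (flag_lab w ` {1..d})"
      by (simp_all add: alternating_on_def)
    then show False
      using top_alternating_unique[of "flag_lab w ` {1..d}" True False] assms(1) by simp
  qed
  have "upper_alternating d = ?P (int d) True \<union> ?P (int d) False"
    unfolding upper_alternating_def ex_bool_eq by (simp only: Collect_disj_eq[symmetric] conj_disj_distribL)
  then show ?thesis
    unfolding split card_Un_disjoint[OF fin fin disj1] card_neg
    by (simp only: card_Un_disjoint[OF fin fin disj2])
qed

text \<open>Double counting of pairs of a chain and an alternating facet of it with top sign
  \<open>+\<close>. Counted by chains, the parity detects the alternating ones; counted by facets,
  inner ones pair up and only the boundary remains.\<close>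

lemma odd_card_upper_alternating_Suc:
  assumes "1 \<le> d" "Suc d \<le> n"
  shows "odd (card (upper_alternating (Suc d))) \<longleftrightarrow> odd (card (upper_alternating d))"
proof -
  let ?D = "Suc d"
  define U where "U = {w \<in> signed_perms ?D. int ?D \<in> set w}"
  define F where "F w = {i \<in> {1..?D}. alternating_on (flag_lab w) ({1..?D} - {i}) True}" for w
  \<comment> \<open>The boundary facets: only the last member of such a chain reaches position
    \<open>?D\<close>, and it is the one omitted.\<close>
  define R where "R = {(w, i) \<in> Sigma U F. i = ?D \<and> last w = int ?D}"
  have finU: "finite U"
    using finite_signed_perms by (simp add: U_def)
  have finF: "finite (F w)" for w
    by (simp add: F_def)
  have "odd (card (F w)) \<longleftrightarrow> (\<exists>b. alternating_on (flag_lab w) {1..?D} b)" if "w \<in> signed_perms ?D" for w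
    unfolding F_def
    by (rule odd_card_alternating_facets) (use flag_lab_no_complementary[OF that assms(2)] in simp_all)
  then have "upper_alternating ?D = {w \<in> U. odd (card (F w))}"
    unfolding upper_alternating_def U_def by blast
  then have 1: "odd (card (upper_alternating ?D)) \<longleftrightarrow> odd (card (Sigma U F))"
    using finU finF by (simp add: card_SigmaI even_sum_iff)
  have "even (card (Sigma U F - R))"
  proof (rule even_card_involution[where g = "neighbour ?D"])
    show "finite (Sigma U F - R)"
      using finU finF by auto
    fix x assume "x \<in> Sigma U F - R"
    then obtain w i where x: "x = (w, i)" and mem: "w \<in> U" "i \<in> F w" "(w, i) \<notin> R"
      by blast
    have w: "w \<in> signed_perms ?D" "int ?D \<in> set w"
      using mem(1) by (simp_all add: U_def)
    have i: "i \<in> {1..?D}" "alternating_on (flag_lab w) ({1..?D} - {i}) True"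
      using mem(2) by (simp_all add: F_def)
    have last: "\<not> (i = ?D \<and> last w = int ?D)"
      using mem by (simp add: R_def)
    have "last w \<noteq> int ?D" if "i = ?D"
      using last that by blast
    note * = neighbour_signed_perm[OF w i(1) this]
    let ?w' = "fst (neighbour ?D (w, i))"
    have "flag_lab ?w' j = flag_lab w j" if "j \<in> {1..?D} - {i}" for j
      by (rule flag_lab_cong, rule *(5)) (use that in auto)
    then have "alternating_on (flag_lab ?w') ({1..?D} - {i}) True =
        alternating_on (flag_lab w) ({1..?D} - {i}) True"
      by (rule alternating_on_cong)
    then have "alternating_on (flag_lab ?w') ({1..?D} - {i}) True"
      using i(2) by (rule iffD2)
    moreover have "neighbour ?D x = (?w', i)"
      using *(1) by (simp add: x)
    ultimately show "neighbour ?D x \<in> Sigma U F - R"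
      using *(2-4) i(1) by (simp add: U_def F_def R_def)
    show "neighbour ?D (neighbour ?D x) = x" "neighbour ?D x \<noteq> x"
      using *(6,7) by (simp_all add: x)
  qed
  moreover have "card (Sigma U F) = card (Sigma U F - R) + card R"
  proof -
    have "R \<subseteq> Sigma U F"
      by (auto simp: R_def)
    moreover have "finite (Sigma U F)"
      using finU finF by blast
    ultimately show ?thesis
      by (metis card_Diff_subset card_mono finite_subset le_add_diff_inverse2)
  qed
  ultimately have 2: "odd (card (Sigma U F)) \<longleftrightarrow> odd (card R)"
    by simp
  let ?W = "{w \<in> signed_perms d. alternating_on (flag_lab w) {1..d} True}"
  have Diff: "{1..?D} - {?D} = {1..d}"
    by auto
  have lab: "alternating_on (flag_lab (w @ [int ?D])) {1..d} True = alternating_on (flag_lab w) {1..d} True"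
    if "w \<in> signed_perms d" for w
    using that by (intro alternating_on_cong flag_lab_cong) (simp add: signed_perms_def)
  \<comment> \<open>A boundary facet is a chain of one dimension less with \<open>int ?D\<close>
    appended, which does not affect the first \<open>d\<close> labels.\<close>
  have "bij_betw (\<lambda>w. (w @ [int ?D], ?D)) ?W R"
    unfolding bij_betw_def
  proof (intro conjI equalityI subsetI)
    show "inj_on (\<lambda>w. (w @ [int ?D], ?D)) ?W"
      by (simp add: inj_on_def)
    fix p assume "p \<in> (\<lambda>w. (w @ [int ?D], ?D)) ` ?W"
    then obtain w where w: "w \<in> signed_perms d" "alternating_on (flag_lab w) {1..d} True"
      and p: "p = (w @ [int ?D], ?D)"
      by blast
    have "w @ [int ?D] \<in> U"
      using iffD2[OF append_signed_perm_iff w(1)] unfolding U_def by simp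
    moreover have "?D \<in> F (w @ [int ?D])"
      using w lab[OF w(1)] unfolding F_def mem_Collect_eq Diff by simp
    ultimately show "p \<in> R"
      by (simp add: R_def p)
  next
    fix p assume "p \<in> R"
    then obtain w where p: "p = (w, ?D)" and w: "w \<in> U" "?D \<in> F w" "last w = int ?D"
      by (auto simp: R_def)
    have "w \<in> signed_perms ?D" "w \<noteq> []"
      using w(1) by (auto simp: U_def)
    then obtain v where w_eq: "w = v @ [int ?D]"
      using w(3) by (metis append_butlast_last_id)
    have v: "v \<in> signed_perms d"
      using \<open>w \<in> signed_perms ?D\<close> unfolding w_eq append_signed_perm_iff .
    have "alternating_on (flag_lab (v @ [int ?D])) {1..d} True"
      using w(2) unfolding F_def mem_Collect_eq Diff w_eq by blast
    then have "v \<in> ?W"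
      using v unfolding lab[OF v] by blast
    then show "p \<in> (\<lambda>w. (w @ [int ?D], ?D)) ` ?W"
      unfolding p w_eq by (rule imageI)
  qed
  then have 3: "card R = card ?W"
    by (simp add: bij_betw_same_card)
  show ?thesis
    unfolding 1 2 3 by (rule odd_card_alternating_boundary[OF assms(1) Suc_leD[OF assms(2)]])
qed

lemma odd_card_upper_alternating:
  assumes "1 \<le> d" "d \<le> n"
  shows "odd (card (upper_alternating d))"
  using assms
proof (induction d rule: dec_induct)
  case base
  have "w = [1]" if w: "w \<in> signed_perms 1" "int 1 \<in> set w" for w
  proof -
    have "length w = Suc 0"
      using w(1) by (simp add: signed_perms_def)
    then obtain x where "w = [x]"
      unfolding length_Suc_conv by blast
    then show ?thesis
      using w(2) by simp
  qed
  moreover have "[1] \<in> signed_perms 1"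
    by (simp add: signed_perms_def)
  moreover have "alternating_on (flag_lab [1]) {1..1} (flag_lab [1] 1 > 0)"
    using top_alternating_insert[of "{}" "flag_lab [1] 1"] by (simp add: alternating_on_def)
  ultimately have "w \<in> upper_alternating 1 \<longleftrightarrow> w = [1]" for w
    unfolding upper_alternating_def mem_Collect_eq by (metis list.set_intros(1) of_nat_1)
  then have "upper_alternating 1 = {[1]}"
    by blast
  then show ?case by simp
next
  case (step d)
  then show ?case using odd_card_upper_alternating_Suc[of d] by simp
qed

text \<open>An odd count is not zero, so some maximal chain carries \<open>n\<close> distinct
  labels. They are nonzero and never complementary, hence have \<open>n\<close> distinct positive
  absolute values.\<close>

lemma card_labels_ge:
  assumes "\<And>X. X \<in> sign_vectors n \<Longrightarrow> \<bar>lab X\<bar> \<le> int m"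
  shows "n \<le> m"
proof (cases "n = 0")
  case False
  then have "upper_alternating n \<noteq> {}"
    using odd_card_upper_alternating[of n] by auto
  then obtain w where w: "w \<in> signed_perms n" "inj_on (flag_lab w) {1..n}"
    unfolding upper_alternating_def alternating_on_def by blast
  have inj: "inj_on (\<lambda>i. \<bar>flag_lab w i\<bar>) {1..n}"
  proof (rule inj_onI)
    fix i j assume ij: "i \<in> {1..n}" "j \<in> {1..n}" "\<bar>flag_lab w i\<bar> = \<bar>flag_lab w j\<bar>"
    then have "flag_lab w i = flag_lab w j"
      using flag_lab_no_complementary[OF w(1) order_refl ij(1,2)] by (metis abs_eq_iff)
    then show "i = j"
      using w(2) ij(1,2) by (meson inj_onD)
  qed
  have "\<bar>flag_lab w i\<bar> \<in> {1..int m}" if "i \<in> {1..n}" for i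
    using assms[OF take_signed_perm_in_sign_vectors[OF w(1) order_refl that]]
      flag_lab_no_complementary[OF w(1) order_refl that that]
    by (auto simp: flag_lab_def)
  then have "card {1..n} \<le> card {1..int m}"
    by (intro card_inj_on_le[OF inj]) auto
  then show ?thesis by simp
qed simp

end

section \<open>Patterns in sign vectors\<close>

text \<open>The index \<open>j\<close> is that of the step from term \<open>j\<close> to term
  \<open>j + 1\<close>, so for odd \<open>s\<close> exactly the last step of each block of
  \<open>s\<close> steps is twisted. In such a step, opposite signs force positions of equal
  parity.\<close>

definition twisted_sign :: "nat \<Rightarrow> nat \<Rightarrow> int \<Rightarrow> bool" where
  "twisted_sign s j x \<longleftrightarrow> (if odd s \<and> j mod s = s - 1 then (0 < x) = even x else 0 < x)"

text \<open>The last terms of all patterns with \<open>j\<close> steps inside \<open>X\<close>. The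
  labelling needs only their existence and sign, so earlier terms are forgotten.\<close>

primrec pattern_ends :: "nat \<Rightarrow> int set \<Rightarrow> nat \<Rightarrow> int set" where
  "pattern_ends s X 0 = X"
| "pattern_ends s X (Suc j) =
     {y\<in>X. \<exists>x\<in>pattern_ends s X j. \<bar>x\<bar> < \<bar>y\<bar> \<and> twisted_sign s j x \<noteq> twisted_sign s j y}"

definition pattern_height :: "nat \<Rightarrow> int set \<Rightarrow> nat" where
  "pattern_height s X = (LEAST j. pattern_ends s X (Suc j) = {})"

lemma twisted_sign_uminus: "x \<noteq> 0 \<Longrightarrow> twisted_sign s j (- x) \<longleftrightarrow> \<not> twisted_sign s j x"
  by (auto simp: twisted_sign_def)

lemma pattern_ends_subset: "pattern_ends s X j \<subseteq> X"
  by (cases j) auto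

lemma pattern_ends_mono: "X \<subseteq> Y \<Longrightarrow> pattern_ends s X j \<subseteq> pattern_ends s Y j"
  by (induction j) auto

lemma pattern_ends_uminus:
  assumes "0 \<notin> X"
  shows "pattern_ends s (uminus ` X) j = uminus ` pattern_ends s X j"
proof (induction j)
  case (Suc j)
  have nz: "x \<noteq> 0" if "x \<in> X" for x
    using that assms by auto
  have nz': "x \<noteq> 0" if "x \<in> pattern_ends s X j" for x
    using that pattern_ends_subset nz by blast
  have "(\<exists>x\<in>uminus ` pattern_ends s X j. \<bar>x\<bar> < \<bar>- y\<bar> \<and> twisted_sign s j x \<noteq> twisted_sign s j (- y)) \<longleftrightarrow>
      (\<exists>x\<in>pattern_ends s X j. \<bar>x\<bar> < \<bar>y\<bar> \<and> twisted_sign s j x \<noteq> twisted_sign s j y)" if "y \<in> X" for y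
    using nz[OF that] nz' by (simp add: twisted_sign_uminus) blast
  then show ?case
    unfolding pattern_ends.simps Suc by blast
qed simp

lemma pattern_ends_nonempty_antimono:
  "pattern_ends s X j \<noteq> {} \<Longrightarrow> i \<le> j \<Longrightarrow> pattern_ends s X i \<noteq> {}"
  by (induction j) (auto simp: le_Suc_eq)

text \<open>Of two last terms with different twisted signs, the one of larger absolute value would
  extend a pattern ending in the other. So longest patterns have a well-defined sign.\<close>

lemma twisted_sign_ends_eq:
  assumes X: "X \<in> sign_vectors n" and empty: "pattern_ends s X (Suc j) = {}"
    and xy: "x \<in> pattern_ends s X j" "y \<in> pattern_ends s X j"
  shows "twisted_sign s j x = twisted_sign s j y"
proof -
  have mem: "x \<in> X" "y \<in> X"
    using xy pattern_ends_subset by blast+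
  have "x = y" if "\<bar>x\<bar> = \<bar>y\<bar>"
    using that mem X by (auto simp: sign_vectors_def abs_eq_iff)
  moreover have False if "\<bar>x\<bar> < \<bar>y\<bar>" "twisted_sign s j x \<noteq> twisted_sign s j y"
    using that empty mem xy by auto
  moreover have False if "\<bar>y\<bar> < \<bar>x\<bar>" "twisted_sign s j x \<noteq> twisted_sign s j y"
    using that empty mem xy by auto
  ultimately show ?thesis
    by (metis linorder_neqE_linordered_idom)
qed

lemma pattern_height:
  assumes "X \<noteq> {}" "pattern_ends s X D = {}"
  shows "pattern_ends s X (Suc (pattern_height s X)) = {}"
    and "pattern_ends s X (pattern_height s X) \<noteq> {}"
    and "pattern_height s X < D"
proof -
  obtain d where D: "D = Suc d"
    using assms by (cases D) auto
  show "pattern_ends s X (Suc (pattern_height s X)) = {}"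
    unfolding pattern_height_def by (rule LeastI[of _ d]) (use assms D in simp)
  show "pattern_height s X < D"
    unfolding D less_Suc_eq_le pattern_height_def by (rule Least_le) (use assms D in simp)
  show "pattern_ends s X (pattern_height s X) \<noteq> {}"
  proof (cases "pattern_height s X")
    case (Suc i)
    then show ?thesis
      unfolding pattern_height_def using not_less_Least[of i "\<lambda>j. pattern_ends s X (Suc j) = {}"] by simp
  qed (simp add: assms)
qed

section \<open>Stable sets inside long patterns\<close>

definition pattern :: "nat \<Rightarrow> (nat \<Rightarrow> int) \<Rightarrow> nat \<Rightarrow> bool" where
  "pattern s p m \<longleftrightarrow>
     (\<forall>j<m. \<bar>p j\<bar> < \<bar>p (Suc j)\<bar> \<and> twisted_sign s j (p j) \<noteq> twisted_sign s j (p (Suc j)))"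

lemma pattern_of_end:
  assumes "y \<in> pattern_ends s X m"
  shows "\<exists>p. pattern s p m \<and> p m = y \<and> p ` {..m} \<subseteq> X"
  using assms
proof (induction m arbitrary: y)
  case 0
  then show ?case
    by (intro exI[of _ "\<lambda>_. y"]) (auto simp: pattern_def)
next
  case (Suc m)
  then obtain x where x: "x \<in> pattern_ends s X m" "\<bar>x\<bar> < \<bar>y\<bar>"
    "twisted_sign s m x \<noteq> twisted_sign s m y" and y: "y \<in> X"
    by auto
  from Suc.IH[OF x(1)] obtain p where p: "pattern s p m" "p m = x" "p ` {..m} \<subseteq> X"
    by blast
  have "pattern s (p(Suc m := y)) (Suc m)"
    using p(1,2) x(2,3) by (auto simp: pattern_def less_Suc_eq)
  moreover have "(p(Suc m := y)) ` {..Suc m} \<subseteq> X"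
    using p(3) y by (auto simp: le_Suc_eq)
  ultimately show ?case
    by (metis fun_upd_same)
qed

lemma pattern_abs_growth:
  assumes "pattern s p m" "i + d \<le> m"
  shows "\<bar>p i\<bar> + int d \<le> \<bar>p (i + d)\<bar>"
  using assms(2)
proof (induction d)
  case (Suc d)
  have "\<bar>p (i + d)\<bar> < \<bar>p (Suc (i + d))\<bar>"
    using assms(1) Suc.prems by (simp add: pattern_def)
  then show ?case
    using Suc by simp
qed simp

text \<open>The first \<open>r\<close> steps of a block stop short of its last step, the only one
  that can be twisted.\<close>

lemma pattern_sign_alternates:
  assumes "pattern s p m" "s * i + r \<le> m" "r < s"
  shows "0 < p (s * i + r) \<longleftrightarrow> (0 < p (s * i)) = even r"
  using assms(2,3)
proof (induction r)
  case (Suc r)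
  have "(s * i + r) mod s \<noteq> s - 1"
    using Suc.prems by simp
  moreover have "twisted_sign s (s * i + r) (p (s * i + r)) \<noteq> twisted_sign s (s * i + r) (p (Suc (s * i + r)))"
    using assms(1) Suc.prems by (simp add: pattern_def)
  ultimately have "(0 < p (s * i + r)) \<noteq> (0 < p (Suc (s * i + r)))"
    by (simp add: twisted_sign_def)
  then show ?case
    using Suc by auto
qed simp

text \<open>Only \<open>s - 1\<close> steps lead from the second term to the end, so one unit is
  missing. For odd \<open>s\<close> the last step joins opposite signs, and the twist makes the
  positions equal in parity, hence at least 2 apart. For even \<open>s\<close> the end signs agree,
  so the case is void.\<close>

lemma pattern_block_sign_change:
  assumes p: "pattern s p m" "s * i + s \<le> m" and s: "s \<ge> 2"
    and sign: "(0 < p (s * i)) \<noteq> (0 < p (s * i + s))"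
  shows "\<bar>p (s * i + 1)\<bar> + int s \<le> \<bar>p (s * i + s)\<bar>"
proof -
  let ?j = "s * i + (s - 1)"
  have "(s - 1 + s * i) mod s = s - 1"
    unfolding mod_mult_self2 using s by simp
  then have j: "Suc ?j = s * i + s" "?j mod s = s - 1"
    using s by (simp_all add: add.commute)
  have alt: "0 < p ?j \<longleftrightarrow> (0 < p (s * i)) = even (s - 1)"
    using p s by (intro pattern_sign_alternates) auto
  have step: "twisted_sign s ?j (p ?j) \<noteq> twisted_sign s ?j (p (s * i + s))" "\<bar>p ?j\<bar> < \<bar>p (s * i + s)\<bar>"
    using p s j(1) unfolding pattern_def by (metis Suc_le_lessD)+
  show ?thesis
  proof (cases "odd s")
    case True
    then have "even (s - 1)"
      by simp
    then have "(0 < p ?j) \<noteq> (0 < p (s * i + s))"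
      using alt sign by simp
    then have "even (p ?j) = even (p (s * i + s))"
      using step(1) True j(2) by (auto simp: twisted_sign_def)
    then have "\<bar>p ?j\<bar> + 2 \<le> \<bar>p (s * i + s)\<bar>"
      using step(2) by presburger
    moreover have "\<bar>p (s * i + 1)\<bar> + int (s - 2) \<le> \<bar>p (s * i + 1 + (s - 2))\<bar>"
      using p s by (intro pattern_abs_growth) auto
    moreover have "s * i + 1 + (s - 2) = ?j"
      using s by simp
    ultimately show ?thesis
      using s by simp
  next
    case False
    then have "odd (s - 1)"
      using s by simp
    then show ?thesis
      using alt sign step(1) False by (simp add: twisted_sign_def)
  qed
qed

definition positive_part :: "int set \<Rightarrow> nat set" where
  "positive_part X = {i. int i \<in> X}"

text \<open>The \<open>s * (k - 1)\<close> steps form \<open>k - 1\<close> full blocks and the start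
  of one more; each of these \<open>k\<close> places contributes one element.\<close>

lemma stable_subset_of_pattern:
  assumes p: "pattern s p (s * (k - 1))" "p ` {..s * (k - 1)} \<subseteq> X" and s: "s \<ge> 2" and k: "k \<ge> 1"
    and X: "X \<in> sign_vectors n"
  shows "\<exists>S\<in>almost_stable_subsets n k s. S \<subseteq> positive_part X \<or> S \<subseteq> positive_part (uminus ` X)"
proof -
  define b where "b = (0 < p (s * (k - 1)))"
  \<comment> \<open>One of the first two terms of each block has the sign of the very last term.\<close>
  define q where "q i = (if (0 < p (s * i)) = b then p (s * i) else p (s * i + 1))" for i
  have block: "s * i + s \<le> s * (k - 1)" if "i < k - 1" for i
    using that mult_le_mono2[of "Suc i" "k - 1" s] by simp
  have p_mem: "p j \<in> X" if "j \<le> s * (k - 1)" for j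
    using p(2) that by auto
  have q_sign: "(0 < q i) = b" and q_mem: "q i \<in> X" if i: "i < k" for i
  proof -
    consider "i = k - 1" | "i < k - 1"
      using i by linarith
    then have "(0 < q i) = b \<and> q i \<in> X"
    proof cases
      case 1
      then show ?thesis using p(2) by (auto simp: q_def b_def)
    next
      case 2
      then have "0 < p (s * i + 1) \<longleftrightarrow> (0 < p (s * i)) = even (1 :: nat)"
        using block[OF 2] s by (intro pattern_sign_alternates[OF p(1)]) auto
      moreover have "p (s * i) \<in> X" "p (s * i + 1) \<in> X"
        by (rule p_mem, use block[OF 2] s in linarith)+
      ultimately show ?thesis
        by (auto simp: q_def)
    qed
    then show "(0 < q i) = b" "q i \<in> X" by auto
  qed
  \<comment> \<open>Only from a second term to the next first term are there fewer than
    \<open>s\<close> steps, and there the block changes sign, so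
    \<open>pattern_block_sign_change\<close> applies.\<close>
  have step: "\<bar>q i\<bar> + int s \<le> \<bar>q (Suc i)\<bar>" if "Suc i < k" for i
  proof -
    have i: "i < k - 1"
      using that by simp
    have le: "\<bar>p (s * i)\<bar> + int s \<le> \<bar>p (s * i + s)\<bar>"
      using pattern_abs_growth[OF p(1) block[OF i]] .
    show ?thesis
    proof (cases "(0 < p (s * i + s)) = b")
      case True
      then show ?thesis
        using le pattern_block_sign_change[OF p(1) block[OF i] s] by (auto simp: q_def add.commute)
    next
      case False
      \<comment> \<open>The term at \<open>s * (k - 1)\<close> has sign \<open>b\<close>, so block
        \<open>i + 1\<close> is a full one and its second term exists.\<close>
      then have "i + 1 < k - 1"
        using i unfolding b_def by (metis Suc_eq_plus1 add.commute linorder_neqE_nat mult_Suc_right not_less_eq)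
      then have le': "s * i + s + 1 \<le> s * (k - 1)"
        using block[of "i + 1"] s by simp
      have "\<bar>p (s * i + s)\<bar> + int 1 \<le> \<bar>p (s * i + s + 1)\<bar>"
        using pattern_abs_growth[OF p(1) le'] .
      moreover have "\<bar>p (s * i + 1)\<bar> + int s \<le> \<bar>p (s * i + 1 + s)\<bar>"
        using pattern_abs_growth[OF p(1), of "s * i + 1" s] le' by simp
      ultimately show ?thesis
        using False le by (auto simp: q_def add_ac)
    qed
  qed
  have gap: "\<bar>q i\<bar> + int s \<le> \<bar>q j\<bar>" if "i < j" "j < k" for i j
    using that
  proof (induction j)
    case (Suc j)
    then show ?case
      using step[of j] by (cases "i = j") auto
  qed simp
  have neq: "\<bar>\<bar>q i\<bar> - \<bar>q j\<bar>\<bar> \<ge> int s" if "i < k" "j < k" "i \<noteq> j" for i j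
    using gap[of i j] gap[of j i] that by (cases "i < j") auto
  define S where "S = (\<lambda>i. nat \<bar>q i\<bar>) ` {..<k}"
  have "inj_on (\<lambda>i. nat \<bar>q i\<bar>) {..<k}"
  proof (rule inj_onI, rule ccontr)
    fix i j assume "i \<in> {..<k}" "j \<in> {..<k}" "nat \<bar>q i\<bar> = nat \<bar>q j\<bar>" "i \<noteq> j"
    then show False
      using neq[of i j] s by simp
  qed
  then have "card S = k"
    by (simp add: S_def card_image)
  moreover have "almost_stable s S"
    unfolding almost_stable_def S_def using neq by auto
  moreover have "S \<subseteq> {1..n}"
  proof
    fix x assume "x \<in> S"
    then obtain i where i: "i < k" "x = nat \<bar>q i\<bar>"
      by (auto simp: S_def)
    have "q i \<in> {- int n..int n}" "q i \<noteq> 0"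
      using q_mem[OF i(1)] X by (auto simp: sign_vectors_def)
    then show "x \<in> {1..n}"
      using i(2) by auto
  qed
  moreover have "S \<subseteq> positive_part (if b then X else uminus ` X)"
  proof
    fix x assume "x \<in> S"
    then obtain i where i: "i < k" "x = nat \<bar>q i\<bar>"
      by (auto simp: S_def)
    then have "int x = (if b then q i else - q i)"
      using q_sign[OF i(1)] by auto
    then show "x \<in> positive_part (if b then X else uminus ` X)"
      using q_mem[OF i(1)] by (auto simp: positive_part_def)
  qed
  ultimately show ?thesis
    unfolding almost_stable_subsets_def by (cases b) auto
qed

section \<open>Coloring bounds\<close>

lemma proper_coloring_lower_bound:
  assumes c: "proper_coloring (almost_stable_kneser_graph n k s) m c" and k: "k \<ge> 1" and s: "s \<ge> 2"
  shows "n \<le> s * (k - 1) + m"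
proof -
  let ?D = "s * (k - 1)"
  let ?V = "almost_stable_subsets n k s"
  define K where "K X = c ` {S\<in>?V. S \<subseteq> positive_part X}" for X
  \<comment> \<open>Taken over both sign classes, this colour is the same for \<open>X\<close> and
    its negative, as antipodality demands.\<close>
  define c\<^sub>0 where "c\<^sub>0 X = (LEAST a. a \<in> K X \<union> K (uminus ` X))" for X
  define low where "low X \<longleftrightarrow> pattern_ends s X ?D = {}" for X
  define h where "h X = pattern_height s X" for X
  define pos where "pos X \<longleftrightarrow> (if low X then \<exists>x\<in>pattern_ends s X (h X). twisted_sign s (h X) x
     else c\<^sub>0 X \<in> K X)" for X
  \<comment> \<open>\<open>Suc\<close> keeps labels nonzero: low vectors use the values
    \<open>1\<close> to \<open>?D\<close>, the others \<open>?D + 1\<close> to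
    \<open>?D + m\<close>.\<close>
  define val where "val X = (if low X then Suc (h X) else Suc (?D + c\<^sub>0 X))" for X
  define lab where "lab X = (if pos X then int (val X) else - int (val X))" for X

  \<comment> \<open>Stable sets in the positive part of \<open>X\<close> and in the negative part of
    a \<open>Y\<close> containing \<open>X\<close> are disjoint, hence adjacent; here properness of
    \<open>c\<close> enters.\<close>
  have K_disjoint: "K X \<inter> K (uminus ` Y) = {}" if "X \<subseteq> Y" "Y \<in> sign_vectors n" for X Y
  proof (rule Int_emptyI)
    fix a assume "a \<in> K X" "a \<in> K (uminus ` Y)"
    then obtain S T where ST: "S \<in> ?V" "T \<in> ?V" "S \<subseteq> positive_part X"
      "T \<subseteq> positive_part (uminus ` Y)" "c S = c T"
      unfolding K_def by blast
    have "S \<inter> T = {}"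
    proof (rule Int_emptyI)
      fix i assume "i \<in> S" "i \<in> T"
      then have "int i \<in> Y" "int i \<in> uminus ` Y"
        using ST(3,4) that(1) by (auto simp: positive_part_def)
      then show False
        using that(2) by (auto simp: sign_vectors_def)
    qed
    then have "(S, T) \<in> parcs (almost_stable_kneser_graph n k s)"
      using ST by (simp add: almost_stable_kneser_graph_def)
    then show False
      using c ST(5) unfolding proper_coloring_def by blast
  qed
  have c0_mem: "c\<^sub>0 X \<in> K X \<union> K (uminus ` X)" if X: "X \<in> sign_vectors n" and nlow: "\<not> low X" for X
  proof -
    obtain y where "y \<in> pattern_ends s X ?D"
      using nlow by (auto simp: low_def)
    from pattern_of_end[OF this] obtain p where "pattern s p ?D" "p ` {..?D} \<subseteq> X"
      by blast
    from stable_subset_of_pattern[OF this s k X]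
    have "\<exists>a. a \<in> K X \<union> K (uminus ` X)"
      unfolding K_def by blast
    then show ?thesis
      unfolding c\<^sub>0_def by (rule LeastI_ex)
  qed
  have low_uminus: "low (uminus ` X) = low X" and h_uminus: "h (uminus ` X) = h X"
    and c0_uminus: "c\<^sub>0 (uminus ` X) = c\<^sub>0 X" and pos_uminus: "pos (uminus ` X) = (\<not> pos X)"
    if X: "X \<in> sign_vectors n" for X
  proof -
    have nz: "0 \<notin> X" and ne: "X \<noteq> {}"
      using X by (auto simp: sign_vectors_def)
    note ends = pattern_ends_uminus[OF nz]
    show low: "low (uminus ` X) = low X" and h: "h (uminus ` X) = h X"
      unfolding low_def h_def pattern_height_def ends by simp_all
    have uu: "uminus ` uminus ` X = X"
      by (simp add: image_image)
    show c0: "c\<^sub>0 (uminus ` X) = c\<^sub>0 X"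
      unfolding c\<^sub>0_def uu by (simp add: Un_commute)
    show "pos (uminus ` X) = (\<not> pos X)"
    proof (cases "low X")
      case True
      note ht = pattern_height[OF ne True[unfolded low_def], folded h_def]
      obtain x where x: "x \<in> pattern_ends s X (h X)"
        using ht(2) by blast
      have eq: "twisted_sign s (h X) y = twisted_sign s (h X) x" if "y \<in> pattern_ends s X (h X)" for y
        using twisted_sign_ends_eq[OF X ht(1) that x] .
      have "pos X = twisted_sign s (h X) x"
        unfolding pos_def if_P[OF True] using x eq by metis
      moreover have "twisted_sign s (h X) (- y) \<longleftrightarrow> \<not> twisted_sign s (h X) x"
        if "y \<in> pattern_ends s X (h X)" for y
      proof -
        have "y \<noteq> 0"
          using that nz pattern_ends_subset[of s X "h X"] by (metis subsetD)
        then show ?thesis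
          using twisted_sign_uminus eq[OF that] by simp
      qed
      then have "pos (uminus ` X) = (\<not> twisted_sign s (h X) x)"
        unfolding pos_def low h ends if_P[OF True] bex_simps using x by metis
      ultimately show ?thesis
        by simp
    next
      case False
      have "pos (uminus ` X) \<longleftrightarrow> c\<^sub>0 X \<in> K (uminus ` X)" "pos X \<longleftrightarrow> c\<^sub>0 X \<in> K X"
        using False low c0 by (simp_all add: pos_def)
      then show ?thesis
        using c0_mem[OF X False] K_disjoint[OF order_refl X] by blast
    qed
  qed
  interpret tucker_labelling n lab
  proof
    fix X assume X: "X \<in> sign_vectors n"
    show "lab (uminus ` X) = - lab X"
      using low_uminus[OF X] h_uminus[OF X] c0_uminus[OF X] pos_uminus[OF X]
      by (simp add: lab_def val_def)
    fix Y assume Y: "Y \<in> sign_vectors n" and sub: "X \<subseteq> Y"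
    have ne: "X \<noteq> {}" "Y \<noteq> {}"
      using X Y by (auto simp: sign_vectors_def)
    show "lab X \<noteq> - lab Y"
    proof
      assume eq: "lab X = - lab Y"
      have "val X > 0" "val Y > 0"
        by (simp_all add: val_def)
      then have val: "val X = val Y" and sign: "pos X \<noteq> pos Y"
        using eq unfolding lab_def by (auto split: if_splits)
      have h_less: "h Z < ?D" if "Z \<noteq> {}" "low Z" for Z
        using pattern_height(3)[OF that(1) that(2)[unfolded low_def]] by (simp add: h_def)
      \<comment> \<open>Low values are at most \<open>?D\<close> and the others exceed it, so equal
        values put \<open>X\<close> and \<open>Y\<close> in the same case.\<close>
      have low: "low X = low Y"
        using val h_less[OF ne(1)] h_less[OF ne(2)] unfolding val_def
        by (cases "low X"; cases "low Y") force+
      show False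
      proof (cases "low X")
        case True
        then have lowY: "low Y" and h: "h X = h Y"
          using low val by (auto simp: val_def)
        note hX = pattern_height[OF ne(1) True[unfolded low_def], folded h_def]
        note hY = pattern_height[OF ne(2) lowY[unfolded low_def], folded h_def]
        obtain x where x: "x \<in> pattern_ends s X (h X)"
          using hX(2) by blast
        \<comment> \<open>Enlarging a vector keeps its patterns, so a last term for \<open>X\<close>
          also decides the sign for \<open>Y\<close>.\<close>
        have subY: "pattern_ends s X (h X) \<subseteq> pattern_ends s Y (h Y)"
          unfolding h by (rule pattern_ends_mono[OF sub])
        have "twisted_sign s (h Y) y = twisted_sign s (h Y) x" if "y \<in> pattern_ends s Y (h Y)" for y
          using twisted_sign_ends_eq[OF Y hY(1) that] x subY by blast
        then have "pos X = twisted_sign s (h Y) x" "pos Y = twisted_sign s (h Y) x"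
          unfolding pos_def if_P[OF True] if_P[OF lowY] using x subY h by (metis subsetD)+
        then show False
          using sign by simp
      next
        case False
        then have lowY: "\<not> low Y" and c0: "c\<^sub>0 X = c\<^sub>0 Y"
          using low val by (auto simp: val_def)
        have pos: "pos X \<longleftrightarrow> c\<^sub>0 Y \<in> K X" "pos Y \<longleftrightarrow> c\<^sub>0 Y \<in> K Y"
          using False lowY c0 by (simp_all add: pos_def)
        have mem: "c\<^sub>0 Y \<in> K X \<union> K (uminus ` X)" "c\<^sub>0 Y \<in> K Y \<union> K (uminus ` Y)"
          using c0_mem[OF X False] c0_mem[OF Y lowY] c0 by simp_all
        \<comment> \<open>The common colour cannot occur in the positive part of one vector and the
          negative part of the other.\<close>
        have "K (uminus ` X) \<inter> K Y = {}"
          using K_disjoint[OF image_mono[OF sub] uminus_in_sign_vectors[OF Y]] by (simp add: image_image)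
        then show False
          using sign pos mem K_disjoint[OF sub Y] by blast
      qed
    qed
  qed
  show ?thesis
  proof (rule card_labels_ge)
    fix X assume X: "X \<in> sign_vectors n"
    then have ne: "X \<noteq> {}"
      by (simp add: sign_vectors_def)
    have "val X \<le> ?D + m"
    proof (cases "low X")
      case True
      then show ?thesis
        using pattern_height(3)[OF ne, of s ?D] unfolding val_def h_def low_def by simp
    next
      case False
      have "K Z \<subseteq> {..<m}" for Z
        using c unfolding K_def proper_coloring_def almost_stable_kneser_graph_def by auto
      then have "c\<^sub>0 X < m"
        using c0_mem[OF X False] by blast
      then show ?thesis
        using False by (simp add: val_def)
    qed
    then have "int (val X) \<le> int (?D + m)"
      by (rule of_nat_mono)
    then show "\<bar>lab X\<bar> \<le> int (?D + m)"
      unfolding lab_def by (cases "pos X") (simp_all only: if_True if_False abs_minus_cancel abs_of_nat)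
  qed
qed

section \<open>Upper bound from minima\<close>

lemma almost_stable_spread:
  assumes "finite S" "S \<noteq> {}" "almost_stable s S"
  shows "Min S + s * (card S - 1) \<le> Max S"
  using assms
proof (induction S rule: finite_linorder_max_induct)
  case (insert b A)
  show ?case
  proof (cases "A = {}")
    case False
    have "almost_stable s A"
      using insert.prems(2) by (auto simp: almost_stable_def)
    then have IH: "Min A + s * (card A - 1) \<le> Max A"
      using insert.IH False by simp
    have "Max A \<in> A" "Min A \<in> A"
      using insert.hyps(1) False by simp_all
    then have "Max A < b" "Min A \<le> b"
      using insert.hyps(2) by (auto intro: less_imp_le)
    have "Max A + s \<le> b"
      using insert.prems(2) \<open>Max A \<in> A\<close> \<open>Max A < b\<close> by (auto simp: almost_stable_def)
    moreover have "b \<notin> A"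
      using insert.hyps(2) by blast
    then have "card (insert b A) - 1 = Suc (card A - 1)"
      using insert.hyps(1) False by (simp add: card_gt_0_iff Suc_pred')
    moreover have "Min (insert b A) = Min A"
      using insert.hyps(1) False \<open>Min A \<le> b\<close> by (simp add: min_absorb2 del: Min_le_iff Min_ge_iff)
    moreover have "Max (insert b A) = b"
      using insert.hyps(1) False \<open>Max A < b\<close> by simp
    ultimately show ?thesis
      using IH by simp
  qed simp
qed simp

lemma proper_coloring_Min:
  assumes k: "k \<ge> 1"
  shows "proper_coloring (almost_stable_kneser_graph n k s) (n - s * (k - 1)) (\<lambda>S. Min S - 1)"
proof -
  have S: "S \<noteq> {} \<and> finite S \<and> Min S \<ge> 1 \<and> Min S + s * (k - 1) \<le> n"
    if "S \<in> almost_stable_subsets n k s" for S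
  proof -
    have sub: "S \<subseteq> {1..n}" and card: "card S = k" and st: "almost_stable s S"
      using that by (auto simp: almost_stable_subsets_def)
    have fin: "finite S"
      using sub by (rule finite_subset) simp
    have ne: "S \<noteq> {}"
      using card k by auto
    show ?thesis
      using almost_stable_spread[OF fin ne st] subsetD[OF sub Min_in[OF fin ne]]
        subsetD[OF sub Max_in[OF fin ne]] ne fin unfolding card atLeastAtMost_iff by linarith
  qed
  \<comment> \<open>A vertex \<open>S\<close> forces \<open>s * (k - 1) < n\<close>, so the
    subtraction is not truncated; the shift by one starts the colours at 0.\<close>
  have "Min S - 1 < n - s * (k - 1)" if "S \<in> almost_stable_subsets n k s" for S
    using S[OF that] by linarith
  moreover have "Min S - 1 \<noteq> Min T - 1"
    if "S \<in> almost_stable_subsets n k s" "T \<in> almost_stable_subsets n k s" "S \<inter> T = {}" for S T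
  proof
    assume "Min S - 1 = Min T - 1"
    then have "Min S = Min T"
      using S[OF that(1)] S[OF that(2)] by linarith
    moreover have "Min S \<in> S" "Min T \<in> T"
      using S[OF that(1)] S[OF that(2)] Min_in by blast+
    ultimately show False
      using that(3) by (metis disjoint_iff)
  qed
  ultimately show ?thesis
    unfolding proper_coloring_def almost_stable_kneser_graph_def by auto
qed

theorem theorem2p5:
  fixes n k s :: nat
  assumes "k \<ge> 2" and "s \<ge> 2" and "n \<ge> s * k"
  shows "chromatic_number (almost_stable_kneser_graph n k s) = n - s * (k - 1)"
  unfolding chromatic_number_def
proof (rule Least_equality)
  have k: "k \<ge> 1"
    using assms(1) by simp
  then show "\<exists>c. proper_coloring (almost_stable_kneser_graph n k s) (n - s * (k - 1)) c"
    using proper_coloring_Min by blast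
  fix m assume "\<exists>c. proper_coloring (almost_stable_kneser_graph n k s) m c"
  then have "n \<le> s * (k - 1) + m"
    using proper_coloring_lower_bound k assms(2) by blast
  then show "n - s * (k - 1) \<le> m"
    by simp
qed

end
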